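(* Let $X$ be a Banach space. The space $(\mathcal{K}_C(X),\oplus,\star,d_\infty)$ is a complete metric convex cone with identity element $\gamma(0)$; that is, $(\mathcal{K}_C(X),\oplus,\star)$ is a convex cone with identity element $\gamma(0)=\|\cdot\|$ and $(\mathcal{K}_C(X),d_\infty)$ is a complete metric space.
   Context: Let $(X,\|\cdot\|)$ be a (real) Banach space. A function $f:X\to\mathbb{R}$ is a Katetov map if $|f(x)-f(y)|\le\|x-y\|\le f(x)+f(y)$ for all $x,y\in X$. $\mathcal{K}_C(X)$ is the set of all convex Katetov maps on $X$, with the metric $d_\infty(f,g)=\sup_{x\in X}|f(x)-g(x)|<+\infty$ and the inf-convolution $(f\oplus g)(x):=\inf\{f(y)+g(z): y,z\in X,\ y+z=x\}$. For $x\in X$, $\gamma(x)$ is the function $t\mapsto\|x-t\|$. The external law $\star:\mathbb{R}^+\times\mathcal{K}_C(X)\to\mathcal{K}_C(X)$ (with $\mathbb{R}^+=[0,+\infty)$) is defined by $(\lambda\star f)(x):=\lambda f(x/\lambda)$ for $\lambda>0$, $x\in X$, and $0\star f:=\gamma(0)=\|\cdot\|$. A commutative monoid $(C,\oplus)$ with identity element $e_C$, equipped with a scalar multiplication $\star:\mathbb{R}^+\times C\to C$, is a convex cone if: 1) $1\star c=c$ and $0\star c=e_C$ for all $c\in C$; 2) $(\alpha+\beta)\star c=(\alpha\star c)\oplus(\beta\star c)$ for all $\alpha,\beta\in\mathbb{R}^+$, $c\in C$; 3) $\lambda\star(c\oplus c')=(\lambda\star c)\oplus(\lambda\star c')$ for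 all $\lambda\in\mathbb{R}^+$, $c,c'\in C$. *)

theory Defs
  imports "HOL-Analysis.Analysis" "HOL-Algebra.Group"
begin

definition katetov :: "('a::real_normed_vector \<Rightarrow> real) \<Rightarrow> bool" where
  "katetov f \<longleftrightarrow>
     (\<forall>x y. \<bar>f x - f y\<bar> \<le> norm (x - y) \<and> norm (x - y) \<le> f x + f y)"

definition convex_katetov :: "('a::real_normed_vector \<Rightarrow> real) set" where
  "convex_katetov = {f. katetov f \<and> convex_on UNIV f}"

definition kat_gamma :: "'a::real_normed_vector \<Rightarrow> 'a \<Rightarrow> real" where
  "kat_gamma x = (\<lambda>t. norm (x - t))"

text \<open>The infimum is taken in the reals. Katetov maps are nonnegative (put $x = y$), so for
  them the set below is nonempty and bounded below and \<^term>\<open>Inf\<close> is its true infimum.\<close>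

definition inf_conv ::
    "('a::real_normed_vector \<Rightarrow> real) \<Rightarrow> ('a \<Rightarrow> real) \<Rightarrow> 'a \<Rightarrow> real" where
  "inf_conv f g = (\<lambda>x. Inf {f y + g z | y z. y + z = x})"

text \<open>Only scalars \<open>c \<ge> 0\<close> are meaningful; negative ones are given the value at \<open>0\<close>.\<close>

definition kat_scale :: "real \<Rightarrow> ('a::real_normed_vector \<Rightarrow> real) \<Rightarrow> 'a \<Rightarrow> real" where
  "kat_scale c f = (if c > 0 then (\<lambda>x. c * f (x /\<^sub>R c)) else kat_gamma 0)"

text \<open>The supremum is formed in the extended reals, where it always exists. Its real-valued
  version is nonnegative and symmetric on all pairs of functions, as the locale
  \<^locale>\<open>Metric_space\<close> demands also outside the carrier; it is the true supremum whenever that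
  is finite.\<close>

definition sup_dist_ereal :: "('a \<Rightarrow> real) \<Rightarrow> ('a \<Rightarrow> real) \<Rightarrow> ereal" where
  "sup_dist_ereal f g = (SUP x. ereal \<bar>f x - g x\<bar>)"

definition sup_dist :: "('a \<Rightarrow> real) \<Rightarrow> ('a \<Rightarrow> real) \<Rightarrow> real" where
  "sup_dist f g = real_of_ereal (sup_dist_ereal f g)"

text \<open>Abstract convex cones, unrelated to the convex cones inside a vector space of
  \<^const>\<open>convex_cone\<close>. The law \<open>(a * b) \<star> c = a \<star> (b \<star> c)\<close> is not among the axioms.\<close>

locale abstract_convex_cone = comm_monoid C
  for C :: "('c, 'm) monoid_scheme" (structure) +
  fixes scal :: "real \<Rightarrow> 'c \<Rightarrow> 'c" (infixr "\<star>" 75)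
  assumes scal_closed: "\<lbrakk>a \<ge> 0; c \<in> carrier C\<rbrakk> \<Longrightarrow> a \<star> c \<in> carrier C"
    and scal_one: "c \<in> carrier C \<Longrightarrow> 1 \<star> c = c"
    and scal_zero: "c \<in> carrier C \<Longrightarrow> 0 \<star> c = \<one>"
    and scal_add: "\<lbrakk>a \<ge> 0; b \<ge> 0; c \<in> carrier C\<rbrakk> \<Longrightarrow> (a + b) \<star> c = (a \<star> c) \<otimes> (b \<star> c)"
    and scal_mult: "\<lbrakk>a \<ge> 0; c \<in> carrier C; c' \<in> carrier C\<rbrakk>
                      \<Longrightarrow> a \<star> (c \<otimes> c') = (a \<star> c) \<otimes> (a \<star> c')"

definition convex_katetov_monoid :: "('a::real_normed_vector \<Rightarrow> real) monoid" where
  "convex_katetov_monoid =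
     \<lparr>carrier = convex_katetov, mult = inf_conv, one = kat_gamma 0\<rparr>"

end

theory Submission imports Defs
begin

text \<open>Idea: \<open>c \<le> inf_conv f g x\<close> holds iff \<open>c \<le> f y + g z\<close> for all \<open>y + z = x\<close>, which reduces the
  monoid laws to arithmetic; the unit law is the Lipschitz condition, and additivity in the scalar
  is convexity, the infimum being attained at the proportional splitting of \<open>x\<close>. Two Katetov maps
  differ by at most the sum of their values at \<open>0\<close>, and all the defining inequalities survive
  pointwise limits, whence completeness.\<close>

section \<open>Katetov maps\<close>

lemma katetov_lipschitz: "katetov f \<Longrightarrow> f x \<le> f y + norm (x - y)"
  unfolding katetov_def by (smt (verit))

lemma katetov_norm_le: "katetov f \<Longrightarrow> norm (x - y) \<le> f x + f y"
  unfolding katetov_def by blast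

lemma katetov_nonneg: "katetov f \<Longrightarrow> 0 \<le> f x"
  using katetov_norm_le[of f x x] by simp

text \<open>Exchanging \<open>x\<close> and \<open>y\<close> in the one-sided inequality bounds the
  other sign of the difference, so later verifications stay free of absolute values.\<close>

lemma katetovI:
  assumes "\<And>x y. f x \<le> f y + norm (x - y)" and "\<And>x y. norm (x - y) \<le> f x + f y"
  shows "katetov f"
proof -
  have "\<bar>f x - f y\<bar> \<le> norm (x - y)" for x y
    using assms(1)[of x y] assms(1)[of y x] by (simp add: norm_minus_commute)
  then show ?thesis
    using assms(2) by (simp add: katetov_def)
qed

lemma kat_gamma_0: "kat_gamma 0 = norm"
  by (auto simp: kat_gamma_def)

lemma katetov_norm: "katetov norm"
  by (rule katetovI) (use norm_triangle_sub norm_triangle_ineq4 in blast)+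

lemma convex_on_UNIV_norm: "convex_on UNIV norm"
  using convex_on_dist[of UNIV 0] by simp

section \<open>Infimal convolution\<close>

text \<open>Nonnegativity bounds the set of sums below and the splitting \<open>x + 0\<close> makes
  it nonempty, so \<open>Inf\<close> is a true infimum. Apart from commutativity, every property of
  \<open>inf_conv\<close> is derived from this criterion.\<close>

lemma le_inf_conv_iff:
  assumes "\<And>y. 0 \<le> f y" and "\<And>z. 0 \<le> g z"
  shows "c \<le> inf_conv f g x \<longleftrightarrow> (\<forall>y z. y + z = x \<longrightarrow> c \<le> f y + g z)"
proof -
  have "{f y + g z | y z. y + z = x} \<noteq> {}"
    by (auto intro: exI[of _ x] exI[of _ 0])
  moreover have "bdd_below {f y + g z | y z. y + z = x}"
    by (rule bdd_belowI[of _ 0]) (auto simp: assms)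
  ultimately show ?thesis
    unfolding inf_conv_def by (subst le_cInf_iff) blast+
qed

lemma inf_conv_le:
  assumes "\<And>y. 0 \<le> f y" and "\<And>z. 0 \<le> g z"
  shows "inf_conv f g (y + z) \<le> f y + g z"
  using le_inf_conv_iff[of f g "inf_conv f g (y + z)", OF assms] by blast

lemma inf_conv_nonneg:
  assumes "\<And>y. 0 \<le> f y" and "\<And>z. 0 \<le> g z"
  shows "0 \<le> inf_conv f g x"
  using assms by (simp add: le_inf_conv_iff)

text \<open>Exchanging \<open>y\<close> and \<open>z\<close> turns one set of sums into the other,
  so the two infima agree even where \<open>Inf\<close> is only a default value.\<close>

lemma inf_conv_commute: "inf_conv f g = inf_conv g f"
proof -
  have "{f y + g z | y z. y + z = x} = {g y + f z | y z. y + z = x}" for x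
    by (metis (no_types, opaque_lifting) add.commute)
  then show ?thesis
    by (simp add: inf_conv_def)
qed

lemma inf_conv_assoc:
  assumes f: "\<And>x. 0 \<le> f x" and g: "\<And>x. 0 \<le> g x" and h: "\<And>x. 0 \<le> h x"
  shows "inf_conv (inf_conv f g) h = inf_conv f (inf_conv g h)"
proof
  fix x
  have "c \<le> inf_conv (inf_conv f g) h x \<longleftrightarrow> c \<le> inf_conv f (inf_conv g h) x" for c
  proof -
    \<comment> \<open>Moving \<open>h z\<close> to the left isolates the inner convolution, so that
      the criterion for lower bounds applies a second time.\<close>
    have "c \<le> inf_conv (inf_conv f g) h x \<longleftrightarrow>
        (\<forall>w z. w + z = x \<longrightarrow> c - h z \<le> inf_conv f g w)"
      by (simp add: le_inf_conv_iff inf_conv_nonneg f g h diff_le_eq)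
    also have "\<dots> \<longleftrightarrow> (\<forall>u v z. u + v + z = x \<longrightarrow> c \<le> f u + g v + h z)"
      unfolding le_inf_conv_iff[of f g, OF f g] diff_le_eq by blast
    \<comment> \<open>The summands are rotated to put \<open>f u\<close> last; from here the first
      two steps are run backwards, with \<open>f\<close> in the role of \<open>h\<close>.\<close>
    also have "\<dots> \<longleftrightarrow> (\<forall>u v z. u + (v + z) = x \<longrightarrow> c \<le> g v + h z + f u)"
      by (simp add: ac_simps)
    also have "\<dots> \<longleftrightarrow> (\<forall>u w. u + w = x \<longrightarrow> c - f u \<le> inf_conv g h w)"
      unfolding le_inf_conv_iff[of g h, OF g h] diff_le_eq by blast
    also have "\<dots> \<longleftrightarrow> c \<le> inf_conv f (inf_conv g h) x"
      by (simp add: le_inf_conv_iff inf_conv_nonneg f g h diff_le_eq add.commute)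
    finally show ?thesis .
  qed
  then show "inf_conv (inf_conv f g) h x = inf_conv f (inf_conv g h) x"
    by (meson order_antisym order_refl)
qed

text \<open>For \<open>y + z = x\<close> the difference \<open>x - z\<close> is \<open>y\<close>, so
  the Lipschitz condition reads \<open>f x \<le> norm y + f z\<close>; the splitting
  \<open>0 + x\<close> attains the bound.\<close>

lemma inf_conv_norm_left:
  assumes "katetov f"
  shows "inf_conv norm f = f"
proof
  fix x
  have f: "0 \<le> f y" for y
    using assms by (rule katetov_nonneg)
  have "f x \<le> inf_conv norm f x"
    using katetov_lipschitz[OF assms, of "y + z" z for y z]
    by (auto simp: le_inf_conv_iff f add.commute)
  then show "inf_conv norm f x = f x"
    using inf_conv_le[of norm f 0 x] f by simp
qed

lemma katetov_inf_conv:
  assumes f: "katetov f" and g: "katetov g"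
  shows "katetov (inf_conv f g)"
proof (rule katetovI)
  have nonneg: "0 \<le> f x" "0 \<le> g x" for x
    using f g by (auto intro: katetov_nonneg)
  show "inf_conv f g x \<le> inf_conv f g y + norm (x - y)" for x y
  proof -
    have "inf_conv f g x - norm (x - y) \<le> f u + g v" if "u + v = y" for u v
    proof -
      \<comment> \<open>A splitting \<open>u + v\<close> of \<open>y\<close> becomes one of
        \<open>x\<close> by keeping \<open>u\<close>. The second parts then differ by exactly
        \<open>x - y\<close>, which the Lipschitz condition of \<open>g\<close> absorbs.\<close>
      have "inf_conv f g x \<le> f u + g (x - u)"
        using inf_conv_le[of f g u "x - u", OF nonneg] by simp
      also have "g (x - u) \<le> g v + norm (x - y)"
        using katetov_lipschitz[OF g, of "x - u" v] that by (simp add: algebra_simps)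
      finally show ?thesis
        by simp
    qed
    then have "inf_conv f g x - norm (x - y) \<le> inf_conv f g y"
      by (simp add: le_inf_conv_iff nonneg)
    then show ?thesis
      by simp
  qed
  show "norm (x - y) \<le> inf_conv f g x + inf_conv f g y" for x y
  proof -
    have split: "norm (x - y) \<le> (f u + g v) + (f u' + g v')"
      if "u + v = x" "u' + v' = y" for u v u' v'
    proof -
      have "norm (x - y) \<le> norm (u - u') + norm (v - v')"
        using norm_triangle_ineq[of "u - u'" "v - v'"] that by (auto simp: algebra_simps)
      then show ?thesis
        using katetov_norm_le[OF f, of u u'] katetov_norm_le[OF g, of v v'] by simp
    qed
    \<comment> \<open>The two infima are taken one at a time: first over the splittings of
      \<open>y\<close> with that of \<open>x\<close> fixed, then over those of
      \<open>x\<close>.\<close>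
    have "norm (x - y) - (f u + g v) \<le> inf_conv f g y" if "u + v = x" for u v
      using split[OF that] by (subst le_inf_conv_iff) (auto simp: nonneg diff_le_eq ac_simps)
    then have "norm (x - y) - inf_conv f g y \<le> inf_conv f g x"
      by (subst le_inf_conv_iff) (auto simp: nonneg diff_le_eq ac_simps)
    then show ?thesis
      by simp
  qed
qed

lemma convex_on_inf_conv:
  assumes f: "\<And>x. 0 \<le> f x" "convex_on UNIV f" and g: "\<And>x. 0 \<le> g x" "convex_on UNIV g"
  shows "convex_on UNIV (inf_conv f g)"
proof (intro convex_onI)
  fix t :: real and x y :: 'a
  assume t: "0 < t" "t < 1"
  let ?h = "inf_conv f g"
  let ?w = "(1 - t) *\<^sub>R x + t *\<^sub>R y"
  have split: "?h ?w \<le> (1 - t) * (f u + g v) + t * (f u' + g v')"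
    if "u + v = x" "u' + v' = y" for u v u' v'
  proof -
    \<comment> \<open>Convex combinations of a splitting of \<open>x\<close> and a splitting of
      \<open>y\<close> form a splitting of \<open>?w\<close>.\<close>
    have "?w = ((1 - t) *\<^sub>R u + t *\<^sub>R u') + ((1 - t) *\<^sub>R v + t *\<^sub>R v')"
      using that by (auto simp: algebra_simps)
    then have "?h ?w \<le> f ((1 - t) *\<^sub>R u + t *\<^sub>R u') + g ((1 - t) *\<^sub>R v + t *\<^sub>R v')"
      by (simp only: inf_conv_le[of f g, OF f(1) g(1)])
    also have "\<dots> \<le> ((1 - t) * f u + t * f u') + ((1 - t) * g v + t * g v')"
      using t by (intro add_mono convex_onD[OF f(2)] convex_onD[OF g(2)]) auto
    finally show ?thesis
      by (simp add: algebra_simps)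
  qed
  \<comment> \<open>Again one infimum at a time. The strict bounds on \<open>t\<close> allow
    division by \<open>t\<close> and by \<open>1 - t\<close>, which isolates the sum over which the
    infimum is taken.\<close>
  have "(?h ?w - (1 - t) * (f u + g v)) / t \<le> ?h y" if "u + v = x" for u v
    unfolding le_inf_conv_iff[of f g, OF f(1) g(1)] pos_divide_le_eq[OF t(1)]
    using split[OF that] by (simp only: diff_le_eq ac_simps) simp
  then have "(?h ?w - t * ?h y) / (1 - t) \<le> f u + g v" if "u + v = x" for u v
    using that t by (simp only: pos_divide_le_eq diff_gt_0_iff_gt diff_le_eq ac_simps)
  then have "(?h ?w - t * ?h y) / (1 - t) \<le> ?h x"
    by (simp only: le_inf_conv_iff[of f g, OF f(1) g(1)]) simp
  then show "?h ?w \<le> (1 - t) * ?h x + t * ?h y"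
    using t by (simp add: divide_le_eq algebra_simps)
qed simp

section \<open>Scaling\<close>

lemma kat_scale_pos: "c > 0 \<Longrightarrow> kat_scale c f x = c * f (x /\<^sub>R c)"
  by (simp add: kat_scale_def)

lemma kat_scale_0: "kat_scale 0 f = norm"
  by (simp add: kat_scale_def kat_gamma_0)

lemma katetov_kat_scale:
  assumes "katetov f" and "c \<ge> 0"
  shows "katetov (kat_scale c f)"
proof (cases "c = 0")
  case True
  then show ?thesis
    by (simp add: kat_scale_0 katetov_norm)
next
  case False
  then have c: "c > 0"
    using assms(2) by simp
  \<comment> \<open>The factor outside cancels the dilation inside, so multiplying the two Katetov
    inequalities by \<open>c\<close> reproduces them for the scaled map.\<close>
  have norm_eq: "c * norm (x /\<^sub>R c - y /\<^sub>R c) = norm (x - y)" for x y :: 'a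
    using c by (simp flip: scaleR_diff_right)
  have "c * f (x /\<^sub>R c) \<le> c * f (y /\<^sub>R c) + norm (x - y)" for x y
    using mult_left_mono[OF katetov_lipschitz[OF assms(1), of "x /\<^sub>R c" "y /\<^sub>R c"], of c] c
    by (simp only: distrib_left norm_eq less_imp_le)
  moreover have "norm (x - y) \<le> c * f (x /\<^sub>R c) + c * f (y /\<^sub>R c)" for x y
    using mult_left_mono[OF katetov_norm_le[OF assms(1), of "x /\<^sub>R c" "y /\<^sub>R c"], of c] c
    by (simp only: distrib_left norm_eq less_imp_le)
  ultimately show ?thesis
    using c by (intro katetovI) (simp_all add: kat_scale_pos)
qed

lemma convex_on_kat_scale:
  assumes "convex_on UNIV f" and "c \<ge> 0"
  shows "convex_on UNIV (kat_scale c f)"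
proof (cases "c = 0")
  case True
  then show ?thesis
    by (simp add: kat_scale_0 convex_on_UNIV_norm)
next
  case False
  then have c: "c > 0"
    using assms(2) by simp
  show ?thesis
  proof (intro convex_onI)
    fix t :: real and x y :: 'a
    assume "0 < t" "t < 1"
    then have "f ((1 - t) *\<^sub>R (x /\<^sub>R c) + t *\<^sub>R (y /\<^sub>R c)) \<le> (1 - t) * f (x /\<^sub>R c) + t * f (y /\<^sub>R c)"
      by (intro convex_onD[OF assms(1)]) auto
    from mult_left_mono[OF this, of c] c
    show "kat_scale c f ((1 - t) *\<^sub>R x + t *\<^sub>R y)
        \<le> (1 - t) * kat_scale c f x + t * kat_scale c f y"
      by (simp add: kat_scale_pos algebra_simps)
  qed simp
qed

lemma kat_scale_add:
  assumes f: "katetov f" "convex_on UNIV f" and ab: "a \<ge> 0" "b \<ge> 0"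
  shows "kat_scale (a + b) f = inf_conv (kat_scale a f) (kat_scale b f)"
proof -
  \<comment> \<open>Scalar 0 yields the norm by a separate clause of the definition, so these cases
    reduce to the unit law.\<close>
  consider "a = 0" | "b = 0" | "a > 0" "b > 0"
    using ab by linarith
  then show ?thesis
  proof cases
    case 1
    then show ?thesis
      by (simp add: kat_scale_0 inf_conv_norm_left katetov_kat_scale f ab)
  next
    case 2
    then show ?thesis
      by (simp add: kat_scale_0 inf_conv_commute[of _ norm] inf_conv_norm_left katetov_kat_scale
          f ab)
  next
    case 3
    show ?thesis
    proof
      fix x
      have nonneg: "0 \<le> kat_scale a f y" "0 \<le> kat_scale b f y" for y
        using katetov_nonneg katetov_kat_scale f(1) ab by blast+
      have "kat_scale (a + b) f x \<le> kat_scale a f y + kat_scale b f z" if "y + z = x" for y z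
      proof -
        \<comment> \<open>This is the weight that makes \<open>x /\<^sub>R (a + b)\<close> a convex
          combination of \<open>y /\<^sub>R a\<close> and \<open>z /\<^sub>R b\<close>, so convexity
          of \<open>f\<close> applies.\<close>
        define t where "t = b / (a + b)"
        have t: "0 \<le> t" "t \<le> 1" "(a + b) * (1 - t) = a" "(a + b) * t = b"
          using 3 by (auto simp: t_def field_simps)
        have "x /\<^sub>R (a + b) = (1 - t) *\<^sub>R (y /\<^sub>R a) + t *\<^sub>R (z /\<^sub>R b)"
        proof -
          have "(1 - t) * inverse a = inverse (a + b)" "t * inverse b = inverse (a + b)"
            using 3 by (auto simp: t_def field_simps)
          then show ?thesis
            using that by (auto simp: scaleR_add_right)
        qed
        then have "f (x /\<^sub>R (a + b)) \<le> (1 - t) * f (y /\<^sub>R a) + t * f (z /\<^sub>R b)"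
          using convex_onD[OF f(2) t(1,2), of "y /\<^sub>R a" "z /\<^sub>R b"] by (simp only: UNIV_I)
        then have "(a + b) * f (x /\<^sub>R (a + b))
            \<le> (a + b) * ((1 - t) * f (y /\<^sub>R a) + t * f (z /\<^sub>R b))"
          using 3 by (intro mult_left_mono) auto
        also have "\<dots> = ((a + b) * (1 - t)) * f (y /\<^sub>R a) + ((a + b) * t) * f (z /\<^sub>R b)"
          by (simp only: distrib_left mult.assoc)
        finally show ?thesis
          using 3 t(3,4) by (simp add: kat_scale_pos)
      qed
      then have "kat_scale (a + b) f x \<le> inf_conv (kat_scale a f) (kat_scale b f) x"
        by (simp add: le_inf_conv_iff nonneg)
      moreover have "inf_conv (kat_scale a f) (kat_scale b f) x \<le> kat_scale (a + b) f x"
      proof -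
        \<comment> \<open>In the proportional splitting of \<open>x\<close> both parts rescale to
          the same point \<open>?w\<close>, and the two values add up to
          \<open>(a + b) * f ?w\<close>.\<close>
        let ?w = "x /\<^sub>R (a + b)"
        have "x = a *\<^sub>R ?w + b *\<^sub>R ?w"
          using 3 by (simp flip: scaleR_add_left distrib_right)
        then have "inf_conv (kat_scale a f) (kat_scale b f) x
            \<le> kat_scale a f (a *\<^sub>R ?w) + kat_scale b f (b *\<^sub>R ?w)"
          using inf_conv_le[of "kat_scale a f" "kat_scale b f", OF nonneg] by metis
        also have "\<dots> = kat_scale (a + b) f x"
          using 3 by (simp add: kat_scale_pos distrib_right flip: mult.assoc)
        finally show ?thesis .
      qed
      ultimately show "kat_scale (a + b) f x = inf_conv (kat_scale a f) (kat_scale b f) x"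
        by (rule order_antisym)
    qed
  qed
qed

text \<open>For positive \<open>c\<close>, dilation by \<open>c\<close> matches the splittings of
  \<open>x /\<^sub>R c\<close> with those of \<open>x\<close> and multiplies the sums by
  \<open>c\<close>. For \<open>c = 0\<close> the claim is that the norm is idempotent under
  \<open>inf_conv\<close>.\<close>

lemma kat_scale_inf_conv:
  assumes f: "katetov f" and g: "katetov g" and "c \<ge> 0"
  shows "kat_scale c (inf_conv f g) = inf_conv (kat_scale c f) (kat_scale c g)"
proof (cases "c = 0")
  case True
  then show ?thesis
    by (simp add: kat_scale_0 inf_conv_norm_left katetov_norm)
next
  case False
  then have c: "c > 0"
    using assms(3) by simp
  have nonneg: "0 \<le> f x" "0 \<le> g x" for x
    using f g by (auto intro: katetov_nonneg)
  have nonneg': "0 \<le> kat_scale c f y" "0 \<le> kat_scale c g y" for y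
    using c nonneg by (simp_all add: kat_scale_pos)
  show ?thesis
  proof
    fix x
    have "kat_scale c (inf_conv f g) x \<le> kat_scale c f y + kat_scale c g z" if "y + z = x" for y z
    proof -
      have "inf_conv f g (x /\<^sub>R c) \<le> f (y /\<^sub>R c) + g (z /\<^sub>R c)"
        using inf_conv_le[of f g "y /\<^sub>R c" "z /\<^sub>R c", OF nonneg] that by (auto simp: scaleR_add_right)
      from mult_left_mono[OF this, of c] c show ?thesis
        by (simp add: kat_scale_pos distrib_left)
    qed
    then have "kat_scale c (inf_conv f g) x \<le> inf_conv (kat_scale c f) (kat_scale c g) x"
      by (simp add: le_inf_conv_iff nonneg')
    moreover have "inf_conv (kat_scale c f) (kat_scale c g) x / c \<le> f y + g z"
      if "y + z = x /\<^sub>R c" for y z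
    proof -
      have "x = c *\<^sub>R y + c *\<^sub>R z"
        using that c by (simp flip: scaleR_add_right)
      then show ?thesis
        using inf_conv_le[of "kat_scale c f" "kat_scale c g" "c *\<^sub>R y" "c *\<^sub>R z", OF nonneg'] c
        by (simp add: kat_scale_pos divide_le_eq algebra_simps)
    qed
    then have "inf_conv (kat_scale c f) (kat_scale c g) x / c \<le> inf_conv f g (x /\<^sub>R c)"
      by (simp add: le_inf_conv_iff nonneg)
    then have "inf_conv (kat_scale c f) (kat_scale c g) x \<le> kat_scale c (inf_conv f g) x"
      using c by (simp add: kat_scale_pos divide_le_eq mult.commute)
    ultimately show "kat_scale c (inf_conv f g) x = inf_conv (kat_scale c f) (kat_scale c g) x"
      by (rule order_antisym)
  qed
qed

lemma abstract_convex_cone_convex_katetov: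
  "abstract_convex_cone convex_katetov_monoid kat_scale"
proof -
  have "comm_monoid (convex_katetov_monoid :: ('a \<Rightarrow> real) monoid)"
  proof (rule comm_monoidI, goal_cases)
    \<comment> \<open>Commutativity is handled apart: as a rewrite rule it could reorder the
      convolutions in the other goals.\<close>
    case (5 f g)
    then show ?case
      by (simp add: convex_katetov_monoid_def inf_conv_commute)
  qed (auto simp: convex_katetov_monoid_def kat_gamma_0 convex_katetov_def katetov_norm
      convex_on_UNIV_norm katetov_inf_conv convex_on_inf_conv katetov_nonneg inf_conv_norm_left
      inf_conv_assoc)
  moreover have "abstract_convex_cone_axioms
      (convex_katetov_monoid :: ('a \<Rightarrow> real) monoid) kat_scale"
  proof (unfold_locales, goal_cases)
    case (2 f)
    then show ?case
      by (auto simp: kat_scale_pos)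
  qed (auto simp: convex_katetov_monoid_def kat_gamma_0 convex_katetov_def kat_scale_0
      katetov_kat_scale convex_on_kat_scale kat_scale_add kat_scale_inf_conv)
  ultimately show ?thesis
    by (rule abstract_convex_cone.intro)
qed

section \<open>The supremum metric\<close>

text \<open>Combine \<open>f x \<le> f 0 + norm x\<close> with
  \<open>norm x \<le> g x + g 0\<close>, and likewise with \<open>f\<close> and \<open>g\<close>
  exchanged.\<close>

lemma abs_katetov_diff_le:
  assumes "katetov f" and "katetov g"
  shows "\<bar>f x - g x\<bar> \<le> f 0 + g 0"
  using katetov_lipschitz[OF assms(1), of x 0] katetov_lipschitz[OF assms(2), of x 0]
    katetov_norm_le[OF assms(1), of x 0] katetov_norm_le[OF assms(2), of x 0]
  by simp

lemma sup_dist_ereal_nonneg: "0 \<le> sup_dist_ereal f g"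
  \<comment> \<open>Any point will do, as each term of the supremum is nonnegative;
    \<open>undefined\<close> serves as one.\<close>
  unfolding sup_dist_ereal_def by (rule SUP_upper2[of undefined]) auto

lemma sup_dist_ereal_finite:
  assumes "katetov f" and "katetov g"
  shows "sup_dist_ereal f g < \<infinity>"
proof -
  have "sup_dist_ereal f g \<le> ereal (f 0 + g 0)"
    unfolding sup_dist_ereal_def using abs_katetov_diff_le[OF assms] by (intro SUP_least) simp
  then show ?thesis
    by (auto intro: order_le_less_trans)
qed

text \<open>The extended supremum is finite and nonnegative here, so passing to the reals loses
  nothing. This criterion plays the same role for \<open>sup_dist\<close> as
  \<open>le_inf_conv_iff\<close> for \<open>inf_conv\<close>.\<close>

lemma sup_dist_le_iff:
  assumes "katetov f" and "katetov g"
  shows "sup_dist f g \<le> c \<longleftrightarrow> (\<forall>x. \<bar>f x - g x\<bar> \<le> c)"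
proof -
  have "ereal (sup_dist f g) = sup_dist_ereal f g"
    unfolding sup_dist_def
    using sup_dist_ereal_finite[OF assms] sup_dist_ereal_nonneg[of f g]
    by (intro ereal_real') auto
  then have "sup_dist f g \<le> c \<longleftrightarrow> sup_dist_ereal f g \<le> ereal c"
    by (metis ereal_less_eq(3))
  also have "\<dots> \<longleftrightarrow> (\<forall>x. \<bar>f x - g x\<bar> \<le> c)"
    by (simp add: sup_dist_ereal_def SUP_le_iff)
  finally show ?thesis .
qed

lemma abs_diff_le_sup_dist:
  assumes "katetov f" and "katetov g"
  shows "\<bar>f x - g x\<bar> \<le> sup_dist f g"
  using sup_dist_le_iff[OF assms, of "sup_dist f g"] by simp

lemma sup_dist_nonneg: "0 \<le> sup_dist f g"
  by (simp add: sup_dist_def sup_dist_ereal_nonneg real_of_ereal_pos)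

lemma Metric_space_convex_katetov: "Metric_space convex_katetov sup_dist"
proof
  show "0 \<le> sup_dist f g" for f g :: "'a \<Rightarrow> real"
    by (rule sup_dist_nonneg)
  show "sup_dist f g = sup_dist g f" for f g :: "'a \<Rightarrow> real"
    by (simp add: sup_dist_def sup_dist_ereal_def abs_minus_commute)
next
  fix f g :: "'a \<Rightarrow> real"
  assume "f \<in> convex_katetov" "g \<in> convex_katetov"
  \<comment> \<open>The bound \<open>c = 0\<close> forces the two functions to agree at every
    point.\<close>
  then have "sup_dist f g \<le> 0 \<longleftrightarrow> f = g"
    by (auto simp: convex_katetov_def sup_dist_le_iff)
  then show "sup_dist f g = 0 \<longleftrightarrow> f = g"
    using sup_dist_nonneg[of f g] by linarith
next
  fix f g h :: "'a \<Rightarrow> real"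
  assume "f \<in> convex_katetov" "g \<in> convex_katetov" "h \<in> convex_katetov"
  then have k: "katetov f" "katetov g" "katetov h"
    by (auto simp: convex_katetov_def)
  have "\<bar>f x - h x\<bar> \<le> sup_dist f g + sup_dist g h" for x
    using abs_diff_le_sup_dist[OF k(1,2), of x] abs_diff_le_sup_dist[OF k(2,3), of x] by linarith
  then show "sup_dist f h \<le> sup_dist f g + sup_dist g h"
    by (simp add: sup_dist_le_iff k)
qed

text \<open>Each defining condition is a non-strict inequality between finitely many values. In the
  completeness proof pointwise convergence thus puts the limit into the space, and uniformity serves
  only for convergence in \<open>sup_dist\<close>.\<close>

lemma convex_katetov_pointwise_limit:
  assumes \<sigma>: "\<And>n. \<sigma> n \<in> convex_katetov" and lim: "\<And>x. (\<lambda>n. \<sigma> n x) \<longlonglongrightarrow> F x"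
  shows "F \<in> convex_katetov"
proof -
  have k: "katetov (\<sigma> n)" and c: "convex_on UNIV (\<sigma> n)" for n
    using \<sigma> by (auto simp: convex_katetov_def)
  have "katetov F"
  proof (rule katetovI)
    show "F x \<le> F y + norm (x - y)" for x y
      by (rule LIMSEQ_le[OF lim[of x] tendsto_add[OF lim[of y] tendsto_const]])
        (use katetov_lipschitz[OF k] in blast)
    show "norm (x - y) \<le> F x + F y" for x y
      by (rule LIMSEQ_le_const[OF tendsto_add[OF lim[of x] lim[of y]]])
        (use katetov_norm_le[OF k] in blast)
  qed
  moreover have "convex_on UNIV F"
  proof (intro convex_onI)
    fix t :: real and x y :: 'a
    assume t: "0 < t" "t < 1"
    have "(\<lambda>n. (1 - t) * \<sigma> n x + t * \<sigma> n y) \<longlonglongrightarrow> (1 - t) * F x + t * F y"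
      by (intro tendsto_intros lim)
    then show "F ((1 - t) *\<^sub>R x + t *\<^sub>R y) \<le> (1 - t) * F x + t * F y"
      using t by (intro LIMSEQ_le[OF lim]) (auto intro!: convex_onD[OF c])
  qed simp
  ultimately show ?thesis
    by (simp add: convex_katetov_def)
qed

lemma mcomplete_convex_katetov: "Metric_space.mcomplete convex_katetov sup_dist"
proof -
  interpret Metric_space "convex_katetov :: ('a \<Rightarrow> real) set" sup_dist
    by (rule Metric_space_convex_katetov)
  show ?thesis
    unfolding mcomplete_def
  proof (intro allI impI)
    fix \<sigma> :: "nat \<Rightarrow> 'a \<Rightarrow> real"
    assume Cauchy: "MCauchy \<sigma>"
    then have \<sigma>: "\<sigma> n \<in> convex_katetov" for n
      by (auto simp: MCauchy_def)
    then have k: "katetov (\<sigma> n)" for n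
      by (simp add: convex_katetov_def)
    have uniform: "\<exists>N. \<forall>m\<ge>N. \<forall>n\<ge>N. \<forall>x. \<bar>\<sigma> m x - \<sigma> n x\<bar> < e" if "e > 0" for e
    proof -
      obtain N where "sup_dist (\<sigma> m) (\<sigma> n) < e" if "N \<le> m" "N \<le> n" for m n
        using Cauchy \<open>e > 0\<close> unfolding MCauchy_def by blast
      then show ?thesis
        using abs_diff_le_sup_dist[OF k k] by (meson order_le_less_trans)
    qed
    have "Cauchy (\<lambda>n. \<sigma> n x)" for x
      unfolding Cauchy_def dist_real_def using uniform by meson
    then have "\<forall>x. \<exists>l. (\<lambda>n. \<sigma> n x) \<longlonglongrightarrow> l"
      by (simp add: Cauchy_convergent_iff convergent_def)
    then obtain F where F: "(\<lambda>n. \<sigma> n x) \<longlonglongrightarrow> F x" for x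
      by metis
    have F_mem: "F \<in> convex_katetov"
      using \<sigma> F by (rule convex_katetov_pointwise_limit)
    have "\<exists>N. \<forall>n\<ge>N. \<sigma> n \<in> convex_katetov \<and> sup_dist (\<sigma> n) F < e" if "e > 0" for e
    proof -
      \<comment> \<open>Half of \<open>e\<close> leaves room for the limit, which turns the strict
        bound into a non-strict one.\<close>
      obtain N where N: "\<bar>\<sigma> m x - \<sigma> n x\<bar> < e / 2" if "m \<ge> N" "n \<ge> N" for m n x
        using uniform[of "e / 2"] \<open>e > 0\<close> by fastforce
      have "sup_dist (\<sigma> n) F < e" if "n \<ge> N" for n
      proof -
        \<comment> \<open>Here \<open>n\<close> stays fixed while the other index tends to infinity;
          \<open>N\<close> does not depend on \<open>x\<close>, so the bound is uniform.\<close>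
        have "\<bar>\<sigma> n x - F x\<bar> \<le> e / 2" for x
          by (rule LIMSEQ_le_const2[OF tendsto_rabs[OF tendsto_diff[OF tendsto_const F]]])
            (use N[OF that] in \<open>meson less_imp_le\<close>)
        then have "sup_dist (\<sigma> n) F \<le> e / 2"
          using F_mem by (subst sup_dist_le_iff) (auto simp: k convex_katetov_def)
        then show ?thesis
          using \<open>e > 0\<close> by linarith
      qed
      then show ?thesis
        using \<sigma> by blast
    qed
    then show "\<exists>F. limitin mtopology \<sigma> F sequentially"
      using F_mem by (auto simp: limit_metric_sequentially)
  qed
qed

theorem proposition7:
  shows "abstract_convex_cone
           (convex_katetov_monoid :: ('a::banach \<Rightarrow> real) monoid) kat_scale
       \<and> kat_gamma (0::'a) = norm
       \<and> (\<forall>f\<in>convex_katetov :: ('a \<Rightarrow> real) set. \<forall>g\<in>convex_katetov. sup_dist_ereal f g < \<infinity>)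
       \<and> Metric_space (convex_katetov :: ('a \<Rightarrow> real) set) sup_dist
       \<and> Metric_space.mcomplete (convex_katetov :: ('a \<Rightarrow> real) set) sup_dist"
  using abstract_convex_cone_convex_katetov kat_gamma_0 Metric_space_convex_katetov
    mcomplete_convex_katetov sup_dist_ereal_finite
  by (auto simp: convex_katetov_def)

end
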